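(* Let $I\subseteq\mathbb{R}$ be a nonempty open interval and let $f,g:I\to\mathbb{R}$ be strictly monotone continuous functions. Let $n\ge 3$ and let $p=(p_1,\dots,p_n):I\to\mathbb{R}_+^n$ and $q=(q_1,\dots,q_n):I\to\mathbb{R}_+^n$. Assume that $p$ is continuous on $I$ and that there exist indices $i,j,k\in\{1,\dots,n\}$ with $i<j<k$ and a nonempty open subinterval $I_0$ of $I$ such that (a) $p_i\circ f^{-1}$, $p_j\circ f^{-1}$ and $p_k\circ f^{-1}$ are continuously differentiable on the interval $f(I_0)$; (b) $g\circ f^{-1}$ is continuously differentiable on the interval $f(I_0)$ with a nonvanishing first derivative. Then the following three assertions are equivalent to each other: (i) The means $A_{f,p}$ and $A_{g,q}$ are globally equal on $I^n$. (ii) The means $A_{f,p}$ and $A_{g,q}$ are locally equal on $I^n$. (iii) There exist $a,b,c,d\in\mathbb{R}$ with $ad\neq bc$ such that $$cf+d>0,\qquad g=\frac{af+b}{cf+d},\qquad\text{and}\qquad q=(cf+d)p$$ hold on $I$.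
   Context: $\mathbb{R}_+$ denotes the set of positive real numbers. For a strictly monotone function $f:I\to\mathbb{R}$, $f^{(-1)}:\mathrm{conv}(f(I))\to I$ denotes its generalized left inverse: the uniquely determined monotone function with $f^{(-1)}(f(x))=x$ for all $x\in I$, where $\mathrm{conv}(S)$ is the smallest interval containing $S$ (if $f$ is continuous, this is the ordinary inverse $f^{-1}:f(I)\to I$). For $p=(p_1,\dots,p_n):I\to\mathbb{R}_+^n$, the $n$-variable generalized Bajraktarević mean $A_{f,p}:I^n\to I$ is defined by $$A_{f,p}(x):=f^{(-1)}\bigg(\frac{p_1(x_1)f(x_1)+\dots+p_n(x_n)f(x_n)}{p_1(x_1)+\dots+p_n(x_n)}\bigg)\qquad (x=(x_1,\dots,x_n)\in I^n).$$ Two functions $F,G:I^n\to\mathbb{R}$ are locally equal on $I^n$ if there is an open set $U\subseteq I^n$ containing the diagonal $\{(x,\dots,x)\mid x\in I\}$ such that $F(x)=G(x)$ for all $x\in U$; they are globally equal on $I^n$ if $F(x)=G(x)$ for all $x\in I^n$. *)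

theory Defs
  imports "HOL-Analysis.Analysis"
begin

abbreviation strictly_monotone_on :: "real set \<Rightarrow> (real \<Rightarrow> real) \<Rightarrow> bool" where
  "strictly_monotone_on I f \<equiv> strict_mono_on I f \<or> strict_antimono_on I f"

(* On the real line the convex hull of a set is the smallest interval containing it.
   Extensionality outside the hull (the E in \<rightarrow>\<^sub>E) makes the description unique among total
   HOL functions. *)
definition gen_left_inv :: "real set \<Rightarrow> (real \<Rightarrow> real) \<Rightarrow> real \<Rightarrow> real" where
  "gen_left_inv I f = (THE h. h \<in> convex hull (f ` I) \<rightarrow>\<^sub>E I \<and>
      (mono_on (convex hull (f ` I)) h \<or> antimono_on (convex hull (f ` I)) h) \<and>
      (\<forall>x\<in>I. h (f x) = x))"

definition baj_mean :: "real set \<Rightarrow> (real \<Rightarrow> real) \<Rightarrow> (real \<Rightarrow> real ^ 'n::finite) \<Rightarrow> real ^ 'n \<Rightarrow> real" where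
  "baj_mean I f p x =
     gen_left_inv I f ((\<Sum>i\<in>UNIV. p (x $ i) $ i * f (x $ i)) / (\<Sum>i\<in>UNIV. p (x $ i) $ i))"

definition cube :: "real set \<Rightarrow> (real ^ 'n::finite) set" where
  "cube I = {x. \<forall>i. x $ i \<in> I}"

definition locally_equal_on :: "real set \<Rightarrow> (real ^ 'n::finite \<Rightarrow> real) \<Rightarrow> (real ^ 'n \<Rightarrow> real) \<Rightarrow> bool" where
  "locally_equal_on I F G \<longleftrightarrow>
     (\<exists>U. open U \<and> U \<subseteq> cube I \<and> (\<forall>t\<in>I. (\<chi> i. t) \<in> U) \<and> (\<forall>x\<in>U. F x = G x))"

definition globally_equal_on :: "real set \<Rightarrow> (real ^ 'n::finite \<Rightarrow> real) \<Rightarrow> (real ^ 'n \<Rightarrow> real) \<Rightarrow> bool" where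
  "globally_equal_on I F G \<longleftrightarrow> (\<forall>x\<in>cube I. F x = G x)"

lemma gen_left_inv_continuous:
  assumes I: "is_interval I" and f: "strictly_monotone_on I f" "continuous_on I f"
  shows "gen_left_inv I f = restrict (inv_into I f) (f ` I)"
proof -
  have inj: "inj_on f I"
    using f(1) by (metis strict_mono_on_imp_inj_on strict_antimono_iff_antimono)
  have "connected (f ` I)"
    using I f(2) by (simp add: connected_continuous_image is_interval_connected)
  then have hull: "convex hull (f ` I) = f ` I"
    by (metis hull_same is_interval_connected_1 is_interval_convex_1)
  have mono: "mono_on (f ` I) (restrict (inv_into I f) (f ` I)) \<or>
              antimono_on (f ` I) (restrict (inv_into I f) (f ` I))"
    using f(1)
  proof
    assume *: "strict_mono_on I f"
    have "mono_on (f ` I) (restrict (inv_into I f) (f ` I))"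
      using * inj strict_mono_on_leD[OF *]
      by (auto simp: monotone_on_def inv_into_f_f) (metis linorder_not_le)
    then show ?thesis ..
  next
    assume *: "strict_antimono_on I f"
    have "antimono_on (f ` I) (restrict (inv_into I f) (f ` I))"
      using * inj
      by (auto simp: monotone_on_def inv_into_f_f) (metis linorder_not_le)
    then show ?thesis ..
  qed
  show ?thesis
    unfolding gen_left_inv_def hull
  proof (rule the_equality)
    fix h
    assume "h \<in> f ` I \<rightarrow>\<^sub>E I \<and> (mono_on (f ` I) h \<or> antimono_on (f ` I) h) \<and> (\<forall>x\<in>I. h (f x) = x)"
    then show "h = restrict (inv_into I f) (f ` I)"
      using inj by (auto intro!: ext simp: restrict_def PiE_def extensional_def inv_into_f_f)
  qed (use mono inj in \<open>auto simp: inv_into_f_f\<close>)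
qed

end

theory Submission
  imports Defs
begin

text \<open>
  The mean \<open>A\<^bsub>f,p\<^esub>\<close> takes the value \<open>s\<close> at \<open>x\<close> iff \<open>\<Sum> \<phi>\<^sub>m(x\<^sub>m) = 0\<close>, where
  \<open>\<phi>\<^sub>m(u) = p\<^sub>m(u) (f(u) - f(s))\<close>; put \<open>\<psi>\<^sub>m(u) = q\<^sub>m(u) (g(u) - g(s))\<close>. Local equality of the means
  says that near the diagonal \<open>\<Sum> \<phi>\<^sub>m(x\<^sub>m) = 0\<close> implies \<open>\<Sum> \<psi>\<^sub>m(x\<^sub>m) = 0\<close>. With at least three variables
  this forces \<open>\<psi>\<^sub>m\<close> to be one and the same additive function of \<open>\<phi>\<^sub>m\<close> for all \<open>m\<close>; it preserves
  signs, so it is linear: \<open>q\<^sub>m(u) (g(u) - g(s)) = l(s) p\<^sub>m(u) (f(u) - f(s))\<close> for \<open>u\<close> and \<open>s\<close> near a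
  given point. Comparing two values of \<open>s\<close> shows that \<open>q\<^sub>m/p\<^sub>m\<close> and \<open>g q\<^sub>m/p\<^sub>m\<close> are locally affine
  functions of \<open>f\<close>, with coefficients independent of \<open>m\<close>. The coefficients are locally
  constant, hence constant on the interval.
\<close>

section \<open>Additive functions on a symmetric interval and relations between sums\<close>

text \<open>Nonnegativity bounds the additive \<open>\<xi>\<close> on \<open>[0, e]\<close>.
  Subtracting the linear function that agrees with it at \<open>e\<close> leaves an additive
  \<open>D\<close> that is bounded there and vanishes at \<open>e\<close>, hence is zero.\<close>

lemma local_additive_nonneg_linear:
  fixes \<xi> :: "real \<Rightarrow> real"
  assumes \<epsilon>: "\<epsilon> > 0"
    and add: "\<And>x y. \<bar>x\<bar> < \<epsilon> \<Longrightarrow> \<bar>y\<bar> < \<epsilon> \<Longrightarrow> \<bar>x + y\<bar> < \<epsilon> \<Longrightarrow> \<xi> (x + y) = \<xi> x + \<xi> y"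
    and nonneg: "\<And>x. 0 \<le> x \<Longrightarrow> x < \<epsilon> \<Longrightarrow> \<xi> x \<ge> 0"
  shows "\<exists>l. \<forall>x. \<bar>x\<bar> < \<epsilon> \<longrightarrow> \<xi> x = l * x"
proof -
  \<comment> \<open>Half the radius, so that a point between \<open>e\<close> and
    \<open>\<epsilon>\<close> is \<open>e\<close> plus a point of \<open>[0, e]\<close>.\<close>
  define e where "e = \<epsilon> / 2"
  define l where "l = \<xi> e / e"
  define D where "D = (\<lambda>x. \<xi> x - l * x)"
  define C where "C = \<xi> e + l * e"
  have e: "0 < e" "e < \<epsilon>" "e + e = \<epsilon>" using \<epsilon> by (auto simp: e_def)
  have l: "l \<ge> 0" using nonneg[of e] e by (auto simp: l_def)
  have D_add: "D (x + y) = D x + D y" if "\<bar>x\<bar> < \<epsilon>" "\<bar>y\<bar> < \<epsilon>" "\<bar>x + y\<bar> < \<epsilon>" for x y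
    using add[OF that] by (simp add: D_def algebra_simps)
  have De: "D e = 0" using e by (simp add: D_def l_def)
  have D_bound: "\<bar>D x\<bar> \<le> C" if "0 \<le> x" "x \<le> e" for x
  proof -
    have "\<xi> e = \<xi> x + \<xi> (e - x)" using add[of x "e - x"] that e by simp
    moreover have "\<xi> x \<ge> 0" "\<xi> (e - x) \<ge> 0" using nonneg that e by auto
    moreover have "0 \<le> l * x" "l * x \<le> l * e" using l that by (auto intro: mult_left_mono)
    ultimately show ?thesis unfolding D_def C_def by linarith
  qed
  \<comment> \<open>Modulo \<open>e\<close> the map \<open>D\<close> commutes with doubling, so a nonzero value would make it unbounded.\<close>
  have D_pow: "2 ^ n * \<bar>D x\<bar> \<le> C" if "0 \<le> x" "x \<le> e" for n x
    using that
  proof (induction n arbitrary: x)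
    case 0
    then show ?case using D_bound by simp
  next
    case (Suc n)
    \<comment> \<open>This is \<open>2 * x\<close> reduced modulo \<open>e\<close>. In the second
      case additivity is applied only to splittings of \<open>e\<close> and of \<open>x\<close>,
      since \<open>x + x\<close> may reach \<open>\<epsilon>\<close>.\<close>
    define x' where "x' = (if x + x \<le> e then x + x else x - (e - x))"
    have x': "0 \<le> x'" "x' \<le> e" using Suc.prems by (auto simp: x'_def)
    have "D x' = 2 * D x"
    proof (cases "x + x \<le> e")
      case True
      then show ?thesis using D_add[of x x] Suc.prems e by (simp add: x'_def)
    next
      case False
      have "D e = D x + D (e - x)" using D_add[of x "e - x"] Suc.prems e by simp
      moreover have "D x = D x' + D (e - x)"
        using D_add[of x' "e - x"] x' Suc.prems e False by (simp add: x'_def)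
      ultimately show ?thesis using De by simp
    qed
    then show ?case using Suc.IH[OF x'] by (simp add: abs_mult algebra_simps)
  qed
  have D0: "D x = 0" if "0 \<le> x" "x \<le> e" for x
  proof (rule ccontr)
    assume "D x \<noteq> 0"
    then obtain n where "C / \<bar>D x\<bar> < 2 ^ n"
      using real_arch_pow[of 2 "C / \<bar>D x\<bar>"] by auto
    then show False using D_pow[OF that, of n] \<open>D x \<noteq> 0\<close> by (simp add: field_simps)
  qed
  have D0': "D x = 0" if "0 \<le> x" "x < \<epsilon>" for x
  proof (cases "x \<le> e")
    case False
    then have "D (e + (x - e)) = D e + D (x - e)" by (intro D_add) (use that e in auto)
    then show ?thesis using De D0[of "x - e"] False that e by simp
  qed (use D0 that in auto)
  have "D x = 0" if "\<bar>x\<bar> < \<epsilon>" for x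
  proof (cases "0 \<le> x")
    case False
    have "D (x + (- x)) = D x + D (- x)" by (intro D_add) (use that in auto)
    then show ?thesis using D0'[of "- x"] D0'[of 0] False that e by simp
  qed (use D0' that in auto)
  then show ?thesis by (auto simp: D_def)
qed

text \<open>With all other variables at \<open>s\<close>, two free variables show that the
  \<open>\<psi> m\<close> depend on the \<open>\<phi> m\<close> through one common odd function;
  three free variables make it additive, and \<open>sign\<close> makes it nonnegative on nonnegative
  arguments.\<close>

lemma sum_zero_imp_proportional:
  fixes \<phi> \<psi> :: "'n::finite \<Rightarrow> real \<Rightarrow> real"
  assumes ijk: "i \<noteq> j" "i \<noteq> k" "j \<noteq> k"
    and \<epsilon>: "\<epsilon> > 0" and s: "s \<in> N" "\<And>m. \<phi> m s = 0" "\<And>m. \<psi> m s = 0"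
    and surj: "\<And>m x. \<bar>x\<bar> < \<epsilon> \<Longrightarrow> \<exists>u\<in>N. \<phi> m u = x"
    and sign: "\<And>u. u \<in> N \<Longrightarrow> \<phi> i u \<ge> 0 \<Longrightarrow> \<psi> i u \<ge> 0"
    and zero: "\<And>u. (\<And>m. u m \<in> N) \<Longrightarrow> (\<Sum>m\<in>UNIV. \<phi> m (u m)) = 0 \<Longrightarrow> (\<Sum>m\<in>UNIV. \<psi> m (u m)) = 0"
  shows "\<exists>l. \<forall>m. \<forall>u\<in>N. \<bar>\<phi> m u\<bar> < \<epsilon> \<longrightarrow> \<psi> m u = l * \<phi> m u"
proof -
  have sum3: "(\<Sum>m\<in>UNIV. \<theta> m (((\<lambda>_. s)(m1 := a, m2 := b, m3 := c)) m)) = \<theta> m1 a + \<theta> m2 b + \<theta> m3 c"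
    if "\<And>m. \<theta> m s = 0" "m1 \<noteq> m2" "m1 \<noteq> m3" "m2 \<noteq> m3"
    for \<theta> :: "'n \<Rightarrow> real \<Rightarrow> real" and m1 m2 m3 a b c
  proof -
    have "(\<Sum>m\<in>UNIV. \<theta> m (((\<lambda>_. s)(m1 := a, m2 := b, m3 := c)) m)) =
          (\<Sum>m\<in>{m1, m2, m3}. \<theta> m (((\<lambda>_. s)(m1 := a, m2 := b, m3 := c)) m))"
      by (rule sum.mono_neutral_right) (use that in auto)
    then show ?thesis using that by simp
  qed
  have zero3: "\<psi> m1 a + \<psi> m2 b + \<psi> m3 c = 0"
    if "m1 \<noteq> m2" "m1 \<noteq> m3" "m2 \<noteq> m3" "a \<in> N" "b \<in> N" "c \<in> N" "\<phi> m1 a + \<phi> m2 b + \<phi> m3 c = 0"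
    for m1 m2 m3 a b c
  proof -
    let ?u = "(\<lambda>_. s)(m1 := a, m2 := b, m3 := c)"
    have "(\<Sum>m\<in>UNIV. \<phi> m (?u m)) = 0"
      unfolding sum3[of \<phi> m1 m2 m3 a b c, OF s(2) that(1-3)] by (rule that(7))
    moreover have "?u m \<in> N" for m using that(4-6) s(1) by simp
    ultimately have "(\<Sum>m\<in>UNIV. \<psi> m (?u m)) = 0" using zero[of ?u] by presburger
    then show ?thesis unfolding sum3[of \<psi> m1 m2 m3 a b c, OF s(3) that(1-3)] .
  qed
  have zero2: "\<psi> m1 a + \<psi> m2 b = 0"
    if m: "m1 \<noteq> m2" "a \<in> N" "b \<in> N" "\<phi> m1 a + \<phi> m2 b = 0" for m1 m2 a b
  proof -
    \<comment> \<open>Some index among \<open>i\<close>, \<open>j\<close>, \<open>k\<close> avoids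
      both \<open>m1\<close> and \<open>m2\<close>; its variable is put at \<open>s\<close>, where
      it contributes nothing.\<close>
    obtain m3 where "m1 \<noteq> m3" "m2 \<noteq> m3" using ijk by metis
    then show ?thesis using zero3[of m1 m2 m3 a b s] m s by simp
  qed
  \<comment> \<open>A chosen right inverse of \<open>\<phi> m\<close> on the values of modulus below
    \<open>\<epsilon>\<close>.\<close>
  define \<gamma> where "\<gamma> = (\<lambda>m x. SOME u. u \<in> N \<and> \<phi> m u = x)"
  have \<gamma>: "\<gamma> m x \<in> N \<and> \<phi> m (\<gamma> m x) = x" if "\<bar>x\<bar> < \<epsilon>" for m x
    unfolding \<gamma>_def by (rule someI_ex) (use surj[OF that, of m] in blast)
  define \<xi> where "\<xi> = (\<lambda>x. \<psi> i (\<gamma> i x))"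
  have \<xi>_add: "\<xi> (x + y) = \<xi> x + \<xi> y" if "\<bar>x\<bar> < \<epsilon>" "\<bar>y\<bar> < \<epsilon>" "\<bar>x + y\<bar> < \<epsilon>" for x y
  proof -
    have m: "\<bar>- y\<bar> < \<epsilon>" "\<bar>- (x + y)\<bar> < \<epsilon>" using that by auto
    have "\<psi> i (\<gamma> i x) + \<psi> j (\<gamma> j y) + \<psi> k (\<gamma> k (- (x + y))) = 0"
      by (rule zero3) (use that ijk \<gamma> m in auto)
    \<comment> \<open>The pair relations carry the terms of indices \<open>j\<close> and
      \<open>k\<close> back to index \<open>i\<close>; that of \<open>j\<close> travels by way of
      \<open>k\<close>.\<close>
    moreover have "\<psi> j (\<gamma> j y) + \<psi> k (\<gamma> k (- y)) = 0" "\<psi> i (\<gamma> i y) + \<psi> k (\<gamma> k (- y)) = 0"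
      "\<psi> i (\<gamma> i (x + y)) + \<psi> k (\<gamma> k (- (x + y))) = 0"
      by (rule zero2; use that ijk \<gamma> m in auto)+
    ultimately show ?thesis unfolding \<xi>_def by linarith
  qed
  have "\<xi> x \<ge> 0" if "0 \<le> x" "x < \<epsilon>" for x
    using sign[of "\<gamma> i x"] \<gamma>[of x i] that by (simp add: \<xi>_def)
  then obtain l where l: "\<And>x. \<bar>x\<bar> < \<epsilon> \<Longrightarrow> \<xi> x = l * x"
    using local_additive_nonneg_linear[of \<epsilon> \<xi>, OF \<epsilon> \<xi>_add] by blast
  have other: "\<psi> m u = l * \<phi> m u" if "m \<noteq> i" "u \<in> N" "\<bar>\<phi> m u\<bar> < \<epsilon>" for m u
  proof -
    have *: "\<bar>- \<phi> m u\<bar> < \<epsilon>" using that by simp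
    have "\<psi> m u + \<psi> i (\<gamma> i (- \<phi> m u)) = 0"
      by (rule zero2) (use that \<gamma>[OF *] in auto)
    then show ?thesis using l[OF *] by (simp add: \<xi>_def)
  qed
  \<comment> \<open>A pair relation needs two distinct indices, so \<open>i\<close> is compared with
    \<open>j\<close>, which \<open>other\<close> already covers.\<close>
  have "\<psi> i u = l * \<phi> i u" if "u \<in> N" "\<bar>\<phi> i u\<bar> < \<epsilon>" for u
  proof -
    have *: "\<bar>- \<phi> i u\<bar> < \<epsilon>" using that by simp
    have "\<psi> i u + \<psi> j (\<gamma> j (- \<phi> i u)) = 0"
      by (rule zero2) (use that ijk \<gamma>[OF *] in auto)
    then show ?thesis using other[of j "\<gamma> j (- \<phi> i u)"] \<gamma>[OF *] ijk that by auto
  qed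
  with other have "\<psi> m u = l * \<phi> m u" if "u \<in> N" "\<bar>\<phi> m u\<bar> < \<epsilon>" for m u
    using that by (cases "m = i") auto
  then show ?thesis by blast
qed

section \<open>Means described by vanishing sums\<close>

lemma baj_mean_quasi_arithmetic:
  fixes p :: "real \<Rightarrow> real ^ 'n::finite"
  assumes I: "is_interval I" and f: "strictly_monotone_on I f" "continuous_on I f"
    and p: "\<forall>x\<in>I. \<forall>m. p x $ m > 0" and x: "x \<in> cube I"
  shows "baj_mean I f p x \<in> I"
    and "f (baj_mean I f p x) = (\<Sum>m\<in>UNIV. p (x $ m) $ m * f (x $ m)) / (\<Sum>m\<in>UNIV. p (x $ m) $ m)"
proof -
  define P where "P = (\<Sum>m\<in>UNIV. p (x $ m) $ m)"
  define M where "M = (\<Sum>m\<in>UNIV. p (x $ m) $ m * f (x $ m)) / P"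
  have xI: "x $ m \<in> I" for m using x by (simp add: cube_def)
  have P: "P > 0" unfolding P_def using p xI by (intro sum_pos) auto
  have "convex (f ` I)"
    using connected_continuous_image[OF f(2) is_interval_connected[OF I]]
    by (simp add: connected_convex_1)
  then have "(\<Sum>m\<in>UNIV. (p (x $ m) $ m / P) *\<^sub>R f (x $ m)) \<in> f ` I"
  proof (rule convex_sum[rotated])
    show "(\<Sum>m\<in>UNIV. p (x $ m) $ m / P) = 1"
      using P by (simp add: P_def flip: sum_divide_distrib)
    show "0 \<le> p (x $ m) $ m / P" for m
      using p xI P by (simp add: less_imp_le)
  qed (use xI in auto)
  also have "(\<Sum>m\<in>UNIV. (p (x $ m) $ m / P) *\<^sub>R f (x $ m)) = M"
    by (simp add: M_def sum_divide_distrib)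
  finally have M: "M \<in> f ` I" .
  then have "baj_mean I f p x = inv_into I f M"
    by (simp add: baj_mean_def gen_left_inv_continuous[OF I f] M_def P_def)
  then show "baj_mean I f p x \<in> I"
    "f (baj_mean I f p x) = (\<Sum>m\<in>UNIV. p (x $ m) $ m * f (x $ m)) / (\<Sum>m\<in>UNIV. p (x $ m) $ m)"
    using M by (simp_all add: inv_into_into f_inv_into_f flip: M_def[unfolded P_def])
qed

text \<open>Injectivity of \<open>f\<close> and multiplication by the positive total weight remove
  the inverse function; means are compared below only through this criterion.\<close>

lemma baj_mean_eq_iff:
  fixes p :: "real \<Rightarrow> real ^ 'n::finite"
  assumes I: "is_interval I" and f: "strictly_monotone_on I f" "continuous_on I f"
    and p: "\<forall>x\<in>I. \<forall>m. p x $ m > 0" and x: "x \<in> cube I" and y: "y \<in> I"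
  shows "baj_mean I f p x = y \<longleftrightarrow> (\<Sum>m\<in>UNIV. p (x $ m) $ m * (f (x $ m) - f y)) = 0"
proof -
  define P where "P = (\<Sum>m\<in>UNIV. p (x $ m) $ m)"
  have inj: "inj_on f I"
    using f(1) by (metis strict_mono_on_imp_inj_on strict_antimono_iff_antimono)
  have P: "P > 0" unfolding P_def using p x by (intro sum_pos) (auto simp: cube_def)
  have "baj_mean I f p x = y \<longleftrightarrow> f (baj_mean I f p x) = f y"
    using inj_on_eq_iff[OF inj baj_mean_quasi_arithmetic(1)[OF I f p x] y] by simp
  also have "\<dots> \<longleftrightarrow> (\<Sum>m\<in>UNIV. p (x $ m) $ m * f (x $ m)) - P * f y = 0"
    using P unfolding baj_mean_quasi_arithmetic(2)[OF I f p x] P_def[symmetric]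
    by (auto simp: field_simps)
  also have "(\<Sum>m\<in>UNIV. p (x $ m) $ m * f (x $ m)) - P * f y =
             (\<Sum>m\<in>UNIV. p (x $ m) $ m * (f (x $ m) - f y))"
    by (simp add: P_def sum_distrib_right sum_subtractf right_diff_distrib)
  finally show ?thesis .
qed

text \<open>Each term of the sum for \<open>g\<close> and \<open>q\<close> is the corresponding term
  for \<open>f\<close> and \<open>p\<close> times a factor that depends only on the value
  \<open>y\<close> of the mean, so both sums vanish.\<close>

lemma moebius_imp_globally_equal:
  fixes p q :: "real \<Rightarrow> real ^ 'n::finite"
  assumes I: "is_interval I"
    and f: "strictly_monotone_on I f" "continuous_on I f"
    and g: "strictly_monotone_on I g" "continuous_on I g"
    and p: "\<forall>x\<in>I. \<forall>m. p x $ m > 0" and q: "\<forall>x\<in>I. \<forall>m. q x $ m > 0"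
    and H: "\<And>x. x \<in> I \<Longrightarrow> c * f x + d > 0 \<and> g x = (a * f x + b) / (c * f x + d) \<and>
                    q x = (c * f x + d) *\<^sub>R p x"
  shows "globally_equal_on I (baj_mean I f p) (baj_mean I g q)"
  unfolding globally_equal_on_def
proof
  fix x :: "real ^ 'n" assume x: "x \<in> cube I"
  define y where "y = baj_mean I f p x"
  have y: "y \<in> I" unfolding y_def by (rule baj_mean_quasi_arithmetic(1)[OF I f p x])
  have xI: "x $ m \<in> I" for m using x by (simp add: cube_def)
  have "(\<Sum>m\<in>UNIV. q (x $ m) $ m * (g (x $ m) - g y)) =
        (\<Sum>m\<in>UNIV. (a * d - b * c) / (c * f y + d) * (p (x $ m) $ m * (f (x $ m) - f y)))"
  proof (rule sum.cong)
    fix m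
    \<comment> \<open>Here \<open>u\<close> and \<open>w\<close> stand for \<open>f (x $ m)\<close>
      and \<open>f y\<close>, and \<open>v\<close> and \<open>z\<close> for the two
      denominators.\<close>
    have *: "v * P * ((a * u + b) / v - (a * w + b) / z) = (a * d - b * c) / z * (P * (u - w))"
      if "v > 0" "z > 0" "v = c * u + d" "z = c * w + d" for u v w z P :: real
    proof -
      have "v * P * ((a * u + b) / v - (a * w + b) / z) = P * ((a * u + b) * z - (a * w + b) * v) / z"
        using that(1,2) by (simp add: field_simps)
      also have "(a * u + b) * z - (a * w + b) * v = (a * d - b * c) * (u - w)"
        unfolding that(3,4) by algebra
      finally show ?thesis by simp
    qed
    show "q (x $ m) $ m * (g (x $ m) - g y) =
        (a * d - b * c) / (c * f y + d) * (p (x $ m) $ m * (f (x $ m) - f y))"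
      using *[of "c * f (x $ m) + d" "c * f y + d" "f (x $ m)" "f y" "p (x $ m) $ m"]
        H[OF xI[of m]] H[OF y] by simp
  qed simp
  also have "\<dots> = (a * d - b * c) / (c * f y + d) * (\<Sum>m\<in>UNIV. p (x $ m) $ m * (f (x $ m) - f y))"
    by (simp add: sum_distrib_left)
  also have "(\<Sum>m\<in>UNIV. p (x $ m) $ m * (f (x $ m) - f y)) = 0"
    using baj_mean_eq_iff[OF I f p x y] y_def by simp
  finally show "baj_mean I f p x = baj_mean I g q x"
    using baj_mean_eq_iff[OF I g q x y] y_def by simp
qed

section \<open>Proportionality near a point\<close>

text \<open>The proportionality lemma is applied at every base point \<open>s\<close> near
  \<open>t\<close> with one common \<open>\<epsilon>\<close>. Its variables range over the compact
  interval \<open>N0\<close>; the smaller \<open>N\<close> keeps all \<open>\<phi> s m u\<close>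
  below \<open>\<epsilon>\<close> in modulus.\<close>

lemma locally_proportional:
  fixes f g :: "real \<Rightarrow> real" and p q :: "real \<Rightarrow> real ^ 'n::finite"
  assumes ijk: "i \<noteq> j" "i \<noteq> k" "(j::'n) \<noteq> k"
    and I: "open I" and f: "strict_mono_on I f" "continuous_on I f" and g: "strict_mono_on I g"
    and p: "\<And>x m. x \<in> I \<Longrightarrow> p x $ m > 0" and q: "\<And>x m. x \<in> I \<Longrightarrow> q x $ m > 0"
    and p_cont: "continuous_on I p"
    and U: "open U" "\<And>t. t \<in> I \<Longrightarrow> (\<chi> i. t) \<in> U"
    and zero: "\<And>x s. x \<in> U \<Longrightarrow> x \<in> cube I \<Longrightarrow> s \<in> I \<Longrightarrow>
        (\<Sum>m\<in>UNIV. p (x $ m) $ m * (f (x $ m) - f s)) = 0 \<Longrightarrow>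
        (\<Sum>m\<in>UNIV. q (x $ m) $ m * (g (x $ m) - g s)) = 0"
    and t: "t \<in> I"
  shows "\<exists>N. open N \<and> t \<in> N \<and> N \<subseteq> I \<and>
     (\<forall>s\<in>N. \<exists>l. \<forall>u\<in>N. \<forall>m. q u $ m * (g u - g s) = l * (p u $ m * (f u - f s)))"
proof -
  \<comment> \<open>A box around the diagonal point inside \<open>U\<close>; \<open>r\<close> is
    chosen so that the cube over \<open>N0\<close> lies in this box.\<close>
  obtain A where A: "\<And>i. open (A i) \<and> t \<in> A i" "\<And>y. (\<forall>i. y $ i \<in> A i) \<Longrightarrow> y \<in> U"
    using U(1) U(2)[OF t] unfolding open_vec_def by fastforce
  have "open ((\<Inter>i. A i) \<inter> I)" "t \<in> (\<Inter>i. A i) \<inter> I"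
    using A(1) I t by (auto intro!: open_Int open_INT)
  then obtain r where r: "r > 0" "cball t r \<subseteq> (\<Inter>i. A i) \<inter> I"
    by (meson open_contains_cball)
  define N0 where "N0 = {t - r..t + r}"
  have N0: "N0 \<subseteq> I" "t \<in> N0" "t - r \<in> N0" "t + r \<in> N0" "N0 \<subseteq> (\<Inter>i. A i)"
    using r by (auto simp: N0_def cball_eq_atLeastAtMost)
  have N0_U: "y \<in> U" if "\<And>i. y $ i \<in> N0" for y
    using A(2) N0(5) that by blast
  define \<phi> where "\<phi> = (\<lambda>s m u. p u $ m * (f u - f s))"
  define \<psi> where "\<psi> = (\<lambda>s m u. q u $ m * (g u - g s))"
  have f_tendsto: "(f \<longlongrightarrow> f t) (nhds t)"
    using f(2) I t by (metis continuous_on_eq_continuous_at continuous_at tendsto_at_iff_tendsto_nhds)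
  have p_tendsto: "((\<lambda>u. p u $ m) \<longlongrightarrow> p t $ m) (nhds t)" for m
    using p_cont I t by (metis continuous_on_eq_continuous_at continuous_at tendsto_at_iff_tendsto_nhds tendsto_vec_nth)
  have ends: "\<phi> t m (t - r) < 0" "0 < \<phi> t m (t + r)" for m
    using p[of "t - r" m] p[of "t + r" m] N0 r t strict_mono_onD[OF f(1), of "t - r" t]
      strict_mono_onD[OF f(1), of t "t + r"]
    by (auto simp: \<phi>_def mult_pos_neg subset_iff)
  \<comment> \<open>At the ends of \<open>N0\<close> the functions \<open>\<phi> t m\<close> have
    strict opposite signs, and there are finitely many \<open>m\<close>, so one small
    \<open>e\<close> serves them all.\<close>
  have "\<forall>\<^sub>F e in at_right 0. \<forall>m. \<phi> t m (t - r) < - e \<and> e < \<phi> t m (t + r)"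
  proof (rule eventually_all_finite)
    fix m
    have "((\<lambda>e. e) \<longlongrightarrow> 0) (at_right (0::real))" "((\<lambda>e. - e) \<longlongrightarrow> 0) (at_right (0::real))"
      by (auto intro!: tendsto_eq_intros)
    from order_tendstoD(2)[OF this(1) ends(2)[of m]] order_tendstoD(1)[OF this(2) ends(1)[of m]]
    show "\<forall>\<^sub>F e in at_right 0. \<phi> t m (t - r) < - e \<and> e < \<phi> t m (t + r)"
      by eventually_elim auto
  qed
  moreover have "\<forall>\<^sub>F e in at_right (0::real). e > 0" by (simp add: eventually_at_right_less)
  ultimately have "\<forall>\<^sub>F e in at_right 0. e > 0 \<and> (\<forall>m. \<phi> t m (t - r) < - e \<and> e < \<phi> t m (t + r))"
    by eventually_elim auto
  then obtain \<epsilon> where \<epsilon>: "\<epsilon> > 0" "\<And>m. \<phi> t m (t - r) < - \<epsilon>" "\<And>m. \<epsilon> < \<phi> t m (t + r)"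
    by (metis (lifting) eventually_happens' trivial_limit_at_right_real)
  \<comment> \<open>The strict inequalities persist for \<open>s\<close> near \<open>t\<close>; by
    the intermediate value theorem \<open>\<phi> s m\<close> then attains on \<open>N0\<close> every
    value of modulus below \<open>\<epsilon>\<close>.\<close>
  have ev_ends: "\<forall>\<^sub>F s in nhds t. \<forall>m. \<phi> s m (t - r) < - \<epsilon> \<and> \<epsilon> < \<phi> s m (t + r)"
  proof (rule eventually_all_finite)
    fix m
    have "((\<lambda>s. \<phi> s m u) \<longlongrightarrow> \<phi> t m u) (nhds t)" for u
      unfolding \<phi>_def by (intro tendsto_intros f_tendsto)
    from order_tendstoD(2)[OF this \<epsilon>(2)[of m]] order_tendstoD(1)[OF this \<epsilon>(3)[of m]]
    show "\<forall>\<^sub>F s in nhds t. \<phi> s m (t - r) < - \<epsilon> \<and> \<epsilon> < \<phi> s m (t + r)"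
      by eventually_elim auto
  qed
  \<comment> \<open>As \<open>s\<close> and \<open>u\<close> both tend to \<open>t\<close>,
    \<open>\<phi> s m u\<close> tends to 0.\<close>
  have "\<forall>\<^sub>F z in nhds t \<times>\<^sub>F nhds t. \<forall>m. \<bar>\<phi> (fst z) m (snd z)\<bar> < \<epsilon>"
  proof (rule eventually_all_finite)
    fix m
    have "((\<lambda>z. \<bar>\<phi> (fst z) m (snd z)\<bar>) \<longlongrightarrow> \<bar>p t $ m * (f t - f t)\<bar>) (nhds t \<times>\<^sub>F nhds t)"
      unfolding \<phi>_def
      by (intro tendsto_intros filterlim_compose[OF f_tendsto] filterlim_compose[OF p_tendsto]
          filterlim_fst filterlim_snd)
    then show "\<forall>\<^sub>F z in nhds t \<times>\<^sub>F nhds t. \<bar>\<phi> (fst z) m (snd z)\<bar> < \<epsilon>"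
      by (rule order_tendstoD) (use \<epsilon> in simp)
  qed
  then obtain S where S: "eventually S (nhds t)" "\<And>s u m. S s \<Longrightarrow> S u \<Longrightarrow> \<bar>\<phi> s m u\<bar> < \<epsilon>"
    unfolding eventually_prod_same by auto
  have "\<forall>\<^sub>F s in nhds t. s \<in> {t - r<..<t + r}"
    using r by (intro eventually_nhds_in_open) auto
  with ev_ends S(1)
  have "\<forall>\<^sub>F s in nhds t. S s \<and> s \<in> N0 \<and> (\<forall>m. \<phi> s m (t - r) < - \<epsilon> \<and> \<epsilon> < \<phi> s m (t + r))"
    by eventually_elim (auto simp: N0_def)
  then obtain N where N: "open N" "t \<in> N"
    and NS: "\<And>s. s \<in> N \<Longrightarrow> S s" "\<And>s. s \<in> N \<Longrightarrow> s \<in> N0"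
    "\<And>s m. s \<in> N \<Longrightarrow> \<phi> s m (t - r) < - \<epsilon>" "\<And>s m. s \<in> N \<Longrightarrow> \<epsilon> < \<phi> s m (t + r)"
    unfolding eventually_nhds by metis
  have "\<exists>l. \<forall>u\<in>N. \<forall>m. \<psi> s m u = l * \<phi> s m u" if s: "s \<in> N" for s
  proof -
    have sI: "s \<in> N0" "s \<in> I" using NS(2)[OF s] N0 by auto
    have "\<exists>l. \<forall>m. \<forall>u\<in>N0. \<bar>\<phi> s m u\<bar> < \<epsilon> \<longrightarrow> \<psi> s m u = l * \<phi> s m u"
    proof (rule sum_zero_imp_proportional[OF ijk \<epsilon>(1) sI(1)])
      fix m x assume x: "\<bar>x\<bar> < \<epsilon>"
      have "continuous_on N0 (\<phi> s m)"
        unfolding \<phi>_def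
        by (intro continuous_intros continuous_on_subset[OF f(2)] continuous_on_subset[OF p_cont] N0)
      then have "\<exists>u\<ge>t - r. u \<le> t + r \<and> \<phi> s m u = x"
        using NS(3,4)[OF s, of m] x r by (intro IVT') (auto simp: N0_def)
      then show "\<exists>u\<in>N0. \<phi> s m u = x" by (auto simp: N0_def)
    next
      fix u assume u: "u \<in> N0" "\<phi> s i u \<ge> 0"
      then have uI: "u \<in> I" using N0 by auto
      then have "f s \<le> f u" using u p[of u i] by (auto simp: \<phi>_def zero_le_mult_iff)
      then have "s \<le> u" using strict_mono_onD[OF f(1) uI sI(2)] by force
      then have "g s \<le> g u" using strict_mono_onD[OF g sI(2) uI] by (cases "s = u") auto
      then show "\<psi> s i u \<ge> 0" using q[OF uI, of i] by (simp add: \<psi>_def)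
    next
      fix u :: "'n \<Rightarrow> real"
      assume u: "\<And>m. u m \<in> N0" "(\<Sum>m\<in>UNIV. \<phi> s m (u m)) = 0"
      then have "(\<chi> m. u m) \<in> U" "(\<chi> m. u m) \<in> cube I"
        using N0(1) by (auto simp: cube_def intro: N0_U)
      from zero[OF this sI(2)] u show "(\<Sum>m\<in>UNIV. \<psi> s m (u m)) = 0"
        by (simp add: \<phi>_def \<psi>_def)
    qed (auto simp: \<phi>_def \<psi>_def)
    then show ?thesis using S(2) NS(1,2) s by meson
  qed
  then show ?thesis using N NS(2) N0(1) unfolding \<phi>_def \<psi>_def
    by (intro exI[of _ N]) auto
qed

section \<open>From local to global coefficients\<close>

lemma affine_eq_at_two_points:
  fixes u v :: real
  assumes "u \<noteq> v" "c * u + d = c' * u + d'" "c * v + d = c' * v + d'"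
  shows "c = c'" "d = d'"
proof -
  have "(c - c') * (u - v) = 0" using assms(2,3) by (simp add: algebra_simps)
  then show "c = c'" using assms(1) by simp
  then show "d = d'" using assms(2) by simp
qed

lemma open_imp_two_points:
  fixes S :: "real set"
  assumes "open S" "t \<in> S"
  shows "\<exists>u v. u \<in> S \<and> v \<in> S \<and> u \<noteq> v"
proof -
  have "S \<noteq> {t}" using assms(1) not_open_singleton by metis
  then show ?thesis using assms(2) by blast
qed

text \<open>Two base points yield the coefficients near each point. They are unique there, hence
  locally constant, hence constant on the connected \<open>I\<close>. The relation for
  \<open>g\<close> stays multiplied out until the sign of \<open>c * f x + d\<close> is
  known.\<close>

lemma proportional_imp_moebius:
  fixes f g :: "real \<Rightarrow> real" and p q :: "real \<Rightarrow> real ^ 'n::finite"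
  assumes I: "connected I" "I \<noteq> {}" and f: "inj_on f I" and g: "inj_on g I"
    and p: "\<And>x m. x \<in> I \<Longrightarrow> p x $ m > 0"
    and loc: "\<And>t. t \<in> I \<Longrightarrow> \<exists>N. open N \<and> t \<in> N \<and> N \<subseteq> I \<and>
     (\<forall>s\<in>N. \<exists>l. \<forall>u\<in>N. \<forall>m. q u $ m * (g u - g s) = l * (p u $ m * (f u - f s)))"
  shows "\<exists>a b c d. \<forall>x\<in>I. (\<forall>m. q x $ m = (c * f x + d) * p x $ m) \<and> (c * f x + d) * g x = a * f x + b"
proof -
  define R where "R = (\<lambda>(a, b, c, d) x. x \<in> I \<and> (\<forall>m. q x $ m = (c * f x + d) * p x $ m) \<and>
     (c * f x + d) * g x = a * f x + b)"
  have ex: "\<exists>z. eventually (R z) (nhds t)" if t: "t \<in> I" for t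
  proof -
    obtain N where N: "open N" "t \<in> N" "N \<subseteq> I"
      "\<And>s. s \<in> N \<Longrightarrow> \<exists>l. \<forall>u\<in>N. \<forall>m. q u $ m * (g u - g s) = l * (p u $ m * (f u - f s))"
      using loc[OF t] by blast
    obtain s s' where s: "s \<in> N" "s' \<in> N" "s \<noteq> s'" using open_imp_two_points[OF N(1,2)] by blast
    obtain l where l: "\<And>u m. u \<in> N \<Longrightarrow> q u $ m * (g u - g s) = l * (p u $ m * (f u - f s))"
      using N(4)[OF s(1)] by blast
    obtain l' where l': "\<And>u m. u \<in> N \<Longrightarrow> q u $ m * (g u - g s') = l' * (p u $ m * (f u - f s'))"
      using N(4)[OF s(2)] by blast
    define h where "h = g s' - g s"
    have h: "h \<noteq> 0" using s N(3) g by (auto simp: h_def inj_on_def)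
    \<comment> \<open>Subtracting the relation at \<open>s'\<close> from that at \<open>s\<close>
      cancels \<open>g u\<close> and leaves \<open>h * q u $ m\<close> as an affine function of
      \<open>f u\<close> times \<open>p u $ m\<close>; \<open>c\<close> and \<open>d\<close> are
      read off from it.\<close>
    define c where "c = (l - l') / h"
    define d where "d = (l' * f s' - l * f s) / h"
    have hc: "h * c = l - l'" and hd: "h * d = l' * f s' - l * f s"
      using h by (simp_all add: c_def d_def)
    have Q: "q u $ m = (c * f u + d) * p u $ m" if "u \<in> N" for u m
    proof -
      have "h * q u $ m = l * (p u $ m * (f u - f s)) - l' * (p u $ m * (f u - f s'))"
        unfolding l[OF that, symmetric] l'[OF that, symmetric] h_def by algebra
      also have "\<dots> = (h * c * f u + h * d) * p u $ m"
        unfolding hc hd by algebra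
      also have "\<dots> = h * ((c * f u + d) * p u $ m)" by algebra
      finally show ?thesis using h by simp
    qed
    \<comment> \<open>Inserting the formula for \<open>q\<close> into the relation at
      \<open>s\<close> and cancelling \<open>p u $ m\<close> gives
      \<open>(c * f u + d) * (g u - g s) = l * (f u - f s)\<close>.\<close>
    moreover have "(c * f u + d) * g u = (c * g s + l) * f u + (d * g s - l * f s)" if u: "u \<in> N" for u
    proof -
      fix m :: 'n
      have "p u $ m * ((c * f u + d) * (g u - g s)) = p u $ m * (l * (f u - f s))"
        using l[OF u, of m] Q[OF u, of m] by (simp add: algebra_simps)
      moreover have "p u $ m \<noteq> 0" using p[of u m] u N(3) by auto
      ultimately have "(c * f u + d) * (g u - g s) = l * (f u - f s)" by simp
      then show ?thesis by (simp add: algebra_simps)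
    qed
    ultimately have "R (c * g s + l, d * g s - l * f s, c, d) u" if "u \<in> N" for u
      unfolding R_def prod.case using that N(3) by blast
    then have "eventually (R (c * g s + l, d * g s - l * f s, c, d)) (nhds t)"
      unfolding eventually_nhds using N(1,2) by blast
    then show ?thesis ..
  qed
  \<comment> \<open>Since \<open>f\<close> is injective, two points near \<open>t\<close> determine
    an affine function of \<open>f\<close>: first \<open>c\<close> and \<open>d\<close> through
    \<open>q\<close>, then \<open>a\<close> and \<open>b\<close> through \<open>g\<close>.\<close>
  have uniq: "z = z'" if z: "eventually (R z) (nhds t)" "eventually (R z') (nhds t)" for t z z'
  proof -
    obtain a b c d where zz: "z = (a, b, c, d)" by (cases z) auto
    obtain a' b' c' d' where zz': "z' = (a', b', c', d')" by (cases z') auto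
    have "eventually (\<lambda>u. R z u \<and> R z' u) (nhds t)" using z by eventually_elim auto
    then obtain N where N: "open N" "t \<in> N" "\<And>u. u \<in> N \<Longrightarrow> R z u \<and> R z' u"
      unfolding eventually_nhds by blast
    then obtain u v where uv: "u \<in> N" "v \<in> N" "u \<noteq> v" using open_imp_two_points by blast
    have fuv: "f u \<noteq> f v" using uv N(3) f by (auto simp: R_def zz inj_on_def)
    have eq: "c * f w + d = c' * f w + d'" if "w \<in> N" for w
    proof -
      fix m :: 'n
      have "(c * f w + d) * p w $ m = (c' * f w + d') * p w $ m" "p w $ m > 0"
        using N(3)[OF that] p[of w m] by (auto simp: R_def zz zz')
      then show ?thesis by simp
    qed
    have cd: "c = c'" "d = d'" using affine_eq_at_two_points[OF fuv eq eq] uv by auto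
    have eq': "a * f w + b = a' * f w + b'" if "w \<in> N" for w
      using N(3)[OF that] cd by (auto simp: R_def zz zz')
    show ?thesis using affine_eq_at_two_points[OF fuv eq' eq'] uv cd by (simp add: zz zz')
  qed
  define Z where "Z = (\<lambda>t. SOME z. eventually (R z) (nhds t))"
  have Z: "eventually (R (Z t)) (nhds t)" if "t \<in> I" for t
    unfolding Z_def using ex[OF that] by (rule someI_ex)
  obtain t0 where t0: "t0 \<in> I" using I by blast
  have "R (Z t0) t" if t: "t \<in> I" for t
  proof -
    have "Z t = Z t0"
    proof (rule connected_local_const[OF I(1) t t0], rule ballI)
      fix x assume x: "x \<in> I"
      \<comment> \<open>The quadruple valid near \<open>x\<close> is also valid near each
        \<open>y\<close> close to \<open>x\<close>, so \<open>uniq\<close> identifies it with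
        \<open>Z y\<close>.\<close>
      have "\<forall>\<^sub>F y in nhds x. eventually (R (Z x)) (nhds y)"
        using Z[OF x] by (simp add: eventually_eventually)
      with Z[OF x] have "\<forall>\<^sub>F y in nhds x. Z x = Z y"
      proof eventually_elim
        case (elim y)
        have "y \<in> I" using elim(1) by (auto simp: R_def split: prod.splits)
        then show ?case using uniq[OF elim(2) Z] by blast
      qed
      then show "\<forall>\<^sub>F y in at x within I. Z x = Z y"
        unfolding eventually_at_filter by eventually_elim simp
    qed
    then show ?thesis using eventually_nhds_x_imp_x[OF Z[OF t]] by simp
  qed
  moreover obtain a b c d where "Z t0 = (a, b, c, d)" by (cases "Z t0") auto
  ultimately show ?thesis
    unfolding R_def by (intro exI[of _ a] exI[of _ b] exI[of _ c] exI[of _ d]) simp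
qed

section \<open>The three assertions\<close>

text \<open>The sign \<open>\<sigma>\<close>, which is 1 or -1, reduces the argument to increasing
  functions.\<close>

lemma strictly_monotone_on_sign:
  assumes "strictly_monotone_on I f"
  obtains \<sigma> where "\<sigma> * \<sigma> = 1" "strict_mono_on I (\<lambda>x. \<sigma> * f x)"
  using assms
proof
  assume "strict_mono_on I f"
  then show thesis using that[of 1] by simp
next
  assume "strict_antimono_on I f"
  then show thesis using that[of "-1"] by (simp add: monotone_on_def)
qed

text \<open>Multiplying \<open>f\<close> and \<open>g\<close> by signs only rescales the vanishing
  sums, so the increasing case applies. Positivity of the denominator follows from that of
  \<open>p\<close> and \<open>q\<close>.\<close>

lemma locally_equal_imp_moebius:
  fixes f g :: "real \<Rightarrow> real" and p q :: "real \<Rightarrow> real ^ 'n::finite"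
  assumes ijk: "i \<noteq> j" "i \<noteq> k" "(j::'n) \<noteq> k"
    and I: "I \<noteq> {}" "open I" "is_interval I"
    and f: "strictly_monotone_on I f" "continuous_on I f"
    and g: "strictly_monotone_on I g" "continuous_on I g"
    and p: "\<forall>x\<in>I. \<forall>m. p x $ m > 0" and q: "\<forall>x\<in>I. \<forall>m. q x $ m > 0"
    and p_cont: "continuous_on I p"
    and eq: "locally_equal_on I (baj_mean I f p) (baj_mean I g q)"
  shows "\<exists>a b c d. a * d \<noteq> b * c \<and>
     (\<forall>x\<in>I. c * f x + d > 0 \<and> g x = (a * f x + b) / (c * f x + d) \<and> q x = (c * f x + d) *\<^sub>R p x)"
proof -
  obtain U where U: "open U" "\<And>t. t \<in> I \<Longrightarrow> (\<chi> i. t) \<in> U"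
    "\<And>x. x \<in> U \<Longrightarrow> baj_mean I f p x = baj_mean I g q x"
    using eq unfolding locally_equal_on_def by blast
  obtain \<sigma> where \<sigma>: "\<sigma> * \<sigma> = 1" "strict_mono_on I (\<lambda>x. \<sigma> * f x)"
    using strictly_monotone_on_sign[OF f(1)] .
  obtain \<tau> where \<tau>: "\<tau> * \<tau> = 1" "strict_mono_on I (\<lambda>x. \<tau> * g x)"
    using strictly_monotone_on_sign[OF g(1)] .
  have nz: "\<sigma> \<noteq> 0" "\<tau> \<noteq> 0" using \<sigma>(1) \<tau>(1) by auto
  have sum_scale: "(\<Sum>m\<in>UNIV. w m * (r * h m - r * e)) = r * (\<Sum>m\<in>UNIV. w m * (h m - e))"
    for w h :: "'n \<Rightarrow> real" and r e
    by (simp add: sum_distrib_left algebra_simps)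
  have inj: "inj_on (\<lambda>x. \<sigma> * f x) I" "inj_on (\<lambda>x. \<tau> * g x) I"
    using \<sigma>(2) \<tau>(2) by (auto intro: strict_mono_on_imp_inj_on)
  have "\<exists>a b c d. \<forall>x\<in>I. (\<forall>m. q x $ m = (c * (\<sigma> * f x) + d) * p x $ m) \<and>
      (c * (\<sigma> * f x) + d) * (\<tau> * g x) = a * (\<sigma> * f x) + b"
  proof (rule proportional_imp_moebius[OF is_interval_connected[OF I(3)] I(1) inj])
    fix t assume t: "t \<in> I"
    show "\<exists>N. open N \<and> t \<in> N \<and> N \<subseteq> I \<and> (\<forall>s\<in>N. \<exists>l. \<forall>u\<in>N. \<forall>m.
        q u $ m * (\<tau> * g u - \<tau> * g s) = l * (p u $ m * (\<sigma> * f u - \<sigma> * f s)))"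
    proof (rule locally_proportional[OF ijk I(2) \<sigma>(2) _ \<tau>(2) _ _ p_cont U(1,2) _ t])
      fix x :: "real ^ 'n" and s
      assume x: "x \<in> U" "x \<in> cube I" and s: "s \<in> I"
        and "(\<Sum>m\<in>UNIV. p (x $ m) $ m * (\<sigma> * f (x $ m) - \<sigma> * f s)) = 0"
      then have "baj_mean I f p x = s"
        using baj_mean_eq_iff[OF I(3) f p x(2) s] nz by (simp add: sum_scale)
      then show "(\<Sum>m\<in>UNIV. q (x $ m) $ m * (\<tau> * g (x $ m) - \<tau> * g s)) = 0"
        using baj_mean_eq_iff[OF I(3) g q x(2) s] U(3)[OF x(1)] by (simp add: sum_scale)
    qed (use p q f(2) in \<open>auto intro: continuous_intros\<close>)
  qed (use p in auto)
  then obtain a b c d where abcd: "\<And>x m. x \<in> I \<Longrightarrow> q x $ m = (c * (\<sigma> * f x) + d) * p x $ m"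
      "\<And>x. x \<in> I \<Longrightarrow> (c * (\<sigma> * f x) + d) * (\<tau> * g x) = a * (\<sigma> * f x) + b"
    by blast
  \<comment> \<open>The signs are moved from \<open>f\<close> and \<open>g\<close> into the
    coefficients; \<open>\<tau>\<close> is its own inverse, and \<open>d\<close> is
    unchanged.\<close>
  define a' b' c' where "a' = \<tau> * \<sigma> * a" and "b' = \<tau> * b" and "c' = \<sigma> * c"
  have q': "q x $ m = (c' * f x + d) * p x $ m" if "x \<in> I" for x m
    using abcd(1)[OF that] by (simp add: c'_def mult_ac)
  have pos: "c' * f x + d > 0" if "x \<in> I" for x
  proof -
    fix m :: 'n
    have "p x $ m > 0" "(c' * f x + d) * p x $ m > 0" using p q q'[OF that] that by auto
    then show ?thesis by (simp add: zero_less_mult_iff)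
  qed
  have g': "(c' * f x + d) * g x = a' * f x + b'" if "x \<in> I" for x
  proof -
    have "(\<tau> * \<tau>) * ((c' * f x + d) * g x) = \<tau> * (a * (\<sigma> * f x) + b)"
      unfolding abcd(2)[OF that, symmetric] by (simp add: c'_def algebra_simps)
    then show ?thesis using \<tau>(1) by (simp add: a'_def b'_def algebra_simps)
  qed
  have g_eq: "g x = (a' * f x + b') / (c' * f x + d)" if "x \<in> I" for x
    using g'[OF that] pos[OF that] by (simp add: field_simps)
  have "a' * d \<noteq> b' * c'"
  proof
    assume det: "a' * d = b' * c'"
    obtain u v where uv: "u \<in> I" "v \<in> I" "u \<noteq> v"
      using I(1,2) open_imp_two_points by blast
    \<comment> \<open>After clearing denominators, \<open>g u - g v\<close> is the determinant times
      \<open>f u - f v\<close>; a zero determinant would contradict injectivity of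
      \<open>g\<close>.\<close>
    have "(c' * f u + d) * (c' * f v + d) * (g u - g v) =
          (c' * f v + d) * ((c' * f u + d) * g u) - (c' * f u + d) * ((c' * f v + d) * g v)"
      by (simp add: algebra_simps)
    also have "\<dots> = (a' * d - b' * c') * (f u - f v)"
      unfolding g'[OF uv(1)] g'[OF uv(2)] by algebra
    finally have "g u = g v" using det pos[OF uv(1)] pos[OF uv(2)] by simp
    then show False using inj(2) uv by (auto simp: inj_on_def)
  qed
  then show ?thesis using pos g_eq q' by (intro exI conjI ballI) (auto simp: vec_eq_iff)
qed

lemma open_cube: "open I \<Longrightarrow> open (cube I)"
  unfolding cube_def by (auto simp: open_vec_def intro!: exI[of _ "\<lambda>_. I"])

lemma globally_equal_imp_locally_equal:
  "open I \<Longrightarrow> globally_equal_on I F G \<Longrightarrow> locally_equal_on I F G"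
  unfolding globally_equal_on_def locally_equal_on_def
  by (intro exI[of _ "cube I"]) (auto simp: open_cube, auto simp: cube_def)

theorem theorem19:
  fixes I I\<^sub>0 :: "real set"
    and f g :: "real \<Rightarrow> real"
    and p q :: "real \<Rightarrow> real ^ 'n::{finite, linorder}"
    and i j k :: 'n
  assumes "I \<noteq> {}" "open I" "is_interval I"
    and "strictly_monotone_on I f" "continuous_on I f"
    and "strictly_monotone_on I g" "continuous_on I g"
    and "CARD('n) \<ge> 3"
    and "\<forall>x\<in>I. \<forall>m. p x $ m > 0"
    and "\<forall>x\<in>I. \<forall>m. q x $ m > 0"
    and "continuous_on I p"
    and "i < j" "j < k"
    and "I\<^sub>0 \<noteq> {}" "open I\<^sub>0" "is_interval I\<^sub>0" "I\<^sub>0 \<subseteq> I"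
    and "\<forall>m\<in>{i, j, k}. (\<lambda>y. p (inv_into I f y) $ m) C1_differentiable_on (f ` I\<^sub>0)"
    and "(g \<circ> inv_into I f) C1_differentiable_on (f ` I\<^sub>0)"
    and "\<forall>y\<in>f ` I\<^sub>0. deriv (g \<circ> inv_into I f) y \<noteq> 0"
  shows "(globally_equal_on I (baj_mean I f p) (baj_mean I g q) \<longleftrightarrow>
          locally_equal_on I (baj_mean I f p) (baj_mean I g q)) \<and>
         (locally_equal_on I (baj_mean I f p) (baj_mean I g q) \<longleftrightarrow>
          (\<exists>a b c d :: real. a * d \<noteq> b * c \<and>
             (\<forall>x\<in>I. c * f x + d > 0 \<and>
                    g x = (a * f x + b) / (c * f x + d) \<and>
                    q x = (c * f x + d) *\<^sub>R p x)))"
proof -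
  have ijk: "i \<noteq> j" "i \<noteq> k" "j \<noteq> k" using assms(12,13) by auto
  note loc = locally_equal_imp_moebius[OF ijk assms(1-7,9-11)]
  note glob = moebius_imp_globally_equal[OF assms(3-7,9,10)]
  note triv = globally_equal_imp_locally_equal[OF assms(2)]
  show ?thesis using loc glob triv by blast
qed

end
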